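(* Let $(X,qp_{bl})$ be a 0-complete quasi-partial b-metric-like space with coefficient $s\ge 1$. Let $T:X\to X$ be a surjective map such that $$qp_{bl}(Tx,Ty)\ge a_1[qp_{bl}(x,y)+qp_{bl}(y,x)]+a_2[qp_{bl}(x,Tx)+qp_{bl}(Tx,x)]+a_3[qp_{bl}(y,Ty)+qp_{bl}(Ty,y)]+a_4[qp_{bl}(x,Ty)+qp_{bl}(Ty,x)]$$ for all $x,y\in X$, where $a_i>0$ for each $i=1,2,3,4$ satisfy $1+a_4-a_3>0$, $s(a_1+a_2)+2s^2(a_3-a_4)+a_4>2s^2$ and $a_1+a_4\ge 1$. Then $T$ has a unique fixed point.
   Context: A quasi-partial b-metric-like on a non-empty set $X$ is a function $qp_{bl}:X\times X\to[0,\infty)$ such that for some real number $s\ge 1$ and all $x,y,z\in X$: (1) if $qp_{bl}(x,y)=0$ then $x=y$; (2) $qp_{bl}(x,x)\le qp_{bl}(x,y)$; (3) $qp_{bl}(x,x)\le qp_{bl}(y,x)$; (4) $qp_{bl}(x,y)\le s[qp_{bl}(x,z)+qp_{bl}(z,y)]-qp_{bl}(z,z)$. The pair $(X,qp_{bl})$ is called a quasi-partial b-metric-like space and $s$ its coefficient. A sequence $\{x_n\}\subseteq X$ is 0-Cauchy if $\lim_{n,m\to\infty}qp_{bl}(x_n,x_m)=0=\lim_{n,m\to\infty}qp_{bl}(x_m,x_n)$. The space $(X,qp_{bl})$ is 0-complete if for every 0-Cauchy sequence $\{x_n\}\subseteq X$ there exists $x\in X$ such that $\lim_{n\to\infty}qp_{bl}(x_n,x)=\lim_{n\to\infty}qp_{bl}(x,x_n)=qp_{bl}(x,x)=0=\lim_{n,m\to\infty}qp_{bl}(x_n,x_m)=\lim_{n,m\to\infty}qp_{bl}(x_m,x_n)$.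 *)

theory Defs
  imports Complex_Main
begin

text \<open>The conditions on \<open>q\<close> concern only its values on \<open>X \<times> X\<close>; nothing is
  assumed outside the carrier. The parameter \<open>s\<close> is the coefficient of the space.\<close>

locale quasi_partial_b_metric_like_space =
  fixes X :: "'a set" and q :: "'a \<Rightarrow> 'a \<Rightarrow> real" and s :: real
  assumes nonempty: "X \<noteq> {}"
    and coefficient: "s \<ge> 1"
    and nonneg: "\<And>x y. \<lbrakk>x \<in> X; y \<in> X\<rbrakk> \<Longrightarrow> 0 \<le> q x y"
    and zero_imp_eq: "\<And>x y. \<lbrakk>x \<in> X; y \<in> X; q x y = 0\<rbrakk> \<Longrightarrow> x = y"
    and self_le_left: "\<And>x y. \<lbrakk>x \<in> X; y \<in> X\<rbrakk> \<Longrightarrow> q x x \<le> q x y"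
    and self_le_right: "\<And>x y. \<lbrakk>x \<in> X; y \<in> X\<rbrakk> \<Longrightarrow> q x x \<le> q y x"
    and triangle: "\<And>x y z. \<lbrakk>x \<in> X; y \<in> X; z \<in> X\<rbrakk> \<Longrightarrow> q x y \<le> s * (q x z + q z y) - q z z"

text \<open>A limit as \<open>n, m \<longrightarrow> \<infinity>\<close> is the joint limit, i.e. along the product filter.\<close>

definition zero_Cauchy :: "'a set \<Rightarrow> ('a \<Rightarrow> 'a \<Rightarrow> real) \<Rightarrow> (nat \<Rightarrow> 'a) \<Rightarrow> bool" where
  "zero_Cauchy X q x \<longleftrightarrow>
     range x \<subseteq> X \<and>
     ((\<lambda>(n, m). q (x n) (x m)) \<longlongrightarrow> 0) (sequentially \<times>\<^sub>F sequentially) \<and>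
     ((\<lambda>(n, m). q (x m) (x n)) \<longlongrightarrow> 0) (sequentially \<times>\<^sub>F sequentially)"

definition zero_complete :: "'a set \<Rightarrow> ('a \<Rightarrow> 'a \<Rightarrow> real) \<Rightarrow> bool" where
  "zero_complete X q \<longleftrightarrow>
     (\<forall>x. zero_Cauchy X q x \<longrightarrow>
       (\<exists>l\<in>X. (\<lambda>n. q (x n) l) \<longlonglongrightarrow> q l l \<and>
              (\<lambda>n. q l (x n)) \<longlonglongrightarrow> q l l \<and>
              q l l = 0 \<and>
              ((\<lambda>(n, m). q (x n) (x m)) \<longlongrightarrow> 0) (sequentially \<times>\<^sub>F sequentially) \<and>
              ((\<lambda>(n, m). q (x m) (x n)) \<longlongrightarrow> 0) (sequentially \<times>\<^sub>F sequentially)))"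

end

theory Submission
  imports Defs
begin

text \<open>
  Everything is read off the symmetrization \<open>d x y = q x y + q y x\<close>, which inherits the relaxed
  triangle inequality and dominates \<open>q\<close> in both orders. The hypothesis on \<open>T\<close> bounds \<open>q (T x) (T y)\<close>
  \<^emph>\<open>from below\<close>, so \<open>T\<close> expands and one iterates backwards: surjectivity gives a sequence with
  \<open>x\<^sub>n = T x\<^sub>n\<^sub>+\<^sub>1\<close>. Inserting \<open>x\<^sub>n\<^sub>+\<^sub>2\<close> and \<open>x\<^sub>n\<^sub>+\<^sub>1\<close> into the hypothesis, and bounding the \<open>a\<^sub>4\<close> term from below
  by the triangle inequality, gives \<open>d x\<^sub>n\<^sub>+\<^sub>1 x\<^sub>n\<^sub>+\<^sub>2 \<le> h * d x\<^sub>n x\<^sub>n\<^sub>+\<^sub>1\<close> with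
  \<open>h = (1 + a\<^sub>4 - a\<^sub>3) / (a\<^sub>1 + a\<^sub>2 + a\<^sub>4 / s)\<close>; the condition with the factors \<open>s\<^sup>2\<close> is exactly
  \<open>2 * s * h < 1\<close>, and \<open>s * h < 1\<close> makes the sequence 0-Cauchy
  (\<open>geometric_steps_imp_zero_Cauchy\<close>).

  By 0-completeness the sequence has a limit \<open>l\<close>. If \<open>T u = l\<close>, then the hypothesis at \<open>x\<^sub>n\<^sub>+\<^sub>1\<close> and \<open>u\<close>
  bounds \<open>a\<^sub>3 * d u l\<close> by \<open>q x\<^sub>n l\<close>, which tends to 0; hence \<open>u = l\<close> is a fixed point. For two fixed
  points \<open>x\<close>, \<open>y\<close> the hypothesis says \<open>q x y \<ge> (a\<^sub>1 + a\<^sub>4) * d x y \<ge> q x y + q y x\<close>, so \<open>q y x = 0\<close>.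
\<close>

context quasi_partial_b_metric_like_space
begin

definition sym_dist :: "'a \<Rightarrow> 'a \<Rightarrow> real" where
  "sym_dist x y = q x y + q y x"

lemma sym_dist_commute: "sym_dist x y = sym_dist y x"
  by (simp add: sym_dist_def)

lemma sym_dist_nonneg: "x \<in> X \<Longrightarrow> y \<in> X \<Longrightarrow> 0 \<le> sym_dist x y"
  by (simp add: sym_dist_def nonneg)

lemma le_sym_dist: "x \<in> X \<Longrightarrow> y \<in> X \<Longrightarrow> q x y \<le> sym_dist x y"
  by (simp add: sym_dist_def nonneg)

lemma sym_dist_self_le: "x \<in> X \<Longrightarrow> y \<in> X \<Longrightarrow> sym_dist x x \<le> sym_dist x y"
  unfolding sym_dist_def by (intro add_mono self_le_left self_le_right)

lemma sym_dist_triangle: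
  assumes "x \<in> X" "y \<in> X" "z \<in> X"
  shows "sym_dist x y \<le> s * (sym_dist x z + sym_dist z y)"
proof -
  have "q x y \<le> s * (q x z + q z y)" "q y x \<le> s * (q y z + q z x)"
    using triangle[of x y z] triangle[of y x z] nonneg[of z z] assms by auto
  then show ?thesis
    by (simp add: sym_dist_def algebra_simps)
qed

text \<open>Applying the triangle inequality from the left end of a chain of points, with the bound
  \<open>C * d x\<^sub>n x\<^sub>n\<^sub>+\<^sub>1\<close> as induction hypothesis for all \<open>n\<close> at once, needs only \<open>s + s * h * C \<le> C\<close>,
  and \<open>1 \<le> C\<close> for the one-point chain, because self-distances may be positive. This is why
  \<open>s * h < 1\<close> suffices: \<open>C = s / (1 - s * h)\<close> solves \<open>s + s * h * C = C\<close> and is at least \<open>s\<close>.\<close>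
lemma geometric_steps_sym_dist_le:
  assumes x: "range x \<subseteq> X" and h: "0 \<le> h" "s * h < 1"
    and step: "\<And>n. sym_dist (x (Suc n)) (x (Suc (Suc n))) \<le> h * sym_dist (x n) (x (Suc n))"
  shows "sym_dist (x n) (x (n + k)) \<le> s / (1 - s * h) * sym_dist (x n) (x (Suc n))"
proof (induction k arbitrary: n)
  case 0
  have "1 - s * h \<le> s"
    using coefficient mult_nonneg_nonneg[of s h] h(1) by linarith
  then have "1 \<le> s / (1 - s * h)"
    using h(2) by simp
  moreover have "sym_dist (x n) (x n) \<le> sym_dist (x n) (x (Suc n))"
    using x by (intro sym_dist_self_le) auto
  moreover have "0 \<le> sym_dist (x n) (x (Suc n))"
    using x by (intro sym_dist_nonneg) auto
  ultimately show ?case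
    using mult_right_mono[of 1 "s / (1 - s * h)" "sym_dist (x n) (x (Suc n))"] by simp
next
  case (Suc k)
  define C where "C = s / (1 - s * h)"
  let ?D = "\<lambda>n. sym_dist (x n) (x (Suc n))"
  have C: "0 \<le> C" "s + s * h * C = C"
    using coefficient h(2) by (auto simp: C_def field_simps)
  have "sym_dist (x n) (x (n + Suc k)) \<le> s * (?D n + sym_dist (x (Suc n)) (x (Suc n + k)))"
    using x sym_dist_triangle[of "x n" "x (n + Suc k)" "x (Suc n)"] by auto
  also have "\<dots> \<le> s * (?D n + C * ?D (Suc n))"
    using coefficient Suc.IH[of "Suc n"] by (intro mult_left_mono add_left_mono) (simp_all add: C_def)
  also have "\<dots> \<le> s * (?D n + C * (h * ?D n))"
    using coefficient C(1) step[of n] by (intro mult_left_mono add_left_mono) simp_all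
  also have "\<dots> = (s + s * h * C) * ?D n"
    by (simp add: algebra_simps)
  also have "\<dots> = C * ?D n"
    by (simp only: C(2))
  finally show ?case
    by (simp add: C_def)
qed

lemma geometric_steps_imp_zero_Cauchy:
  assumes x: "range x \<subseteq> X" and h: "0 \<le> h" "s * h < 1"
    and step: "\<And>n. sym_dist (x (Suc n)) (x (Suc (Suc n))) \<le> h * sym_dist (x n) (x (Suc n))"
  shows "zero_Cauchy X q x"
proof -
  define B where "B = s / (1 - s * h) * sym_dist (x 0) (x 1)"
  have x_in: "x n \<in> X" for n
    using x by auto
  have B: "0 \<le> B"
    using coefficient h(2) sym_dist_nonneg[OF x_in x_in, of 0 1] by (simp add: B_def)
  have "h < 1"
    using coefficient h mult_right_mono[of 1 s h] by simp
  then have pow: "(\<lambda>n. h ^ n) \<longlonglongrightarrow> 0"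
    using h(1) by (intro LIMSEQ_realpow_zero)
  have steps: "sym_dist (x n) (x (Suc n)) \<le> h ^ n * sym_dist (x 0) (x 1)" for n
  proof (induction n)
    case (Suc n)
    then show ?case
      using step[of n] mult_left_mono[OF Suc.IH h(1)] by (simp add: mult.assoc)
  qed simp
  have forward: "sym_dist (x n) (x (n + k)) \<le> B * h ^ n" for n k
  proof -
    have "sym_dist (x n) (x (n + k)) \<le> s / (1 - s * h) * sym_dist (x n) (x (Suc n))"
      using x h step by (rule geometric_steps_sym_dist_le)
    also have "\<dots> \<le> s / (1 - s * h) * (h ^ n * sym_dist (x 0) (x 1))"
      using coefficient h(2) steps by (intro mult_left_mono) simp_all
    finally show ?thesis
      by (simp add: B_def algebra_simps)
  qed
  \<comment> \<open>The sum of both powers avoids a case distinction on the order of the indices in the limit.\<close>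
  have bound: "sym_dist (x n) (x m) \<le> B * (h ^ n + h ^ m)" for n m
  proof (cases "n \<le> m")
    case True
    then show ?thesis
      using forward[of n "m - n"] mult_nonneg_nonneg[OF B zero_le_power[OF h(1), of m]]
      by (simp add: distrib_left)
  next
    case False
    then show ?thesis
      using forward[of m "n - m"] mult_nonneg_nonneg[OF B zero_le_power[OF h(1), of n]]
      by (simp add: distrib_left sym_dist_commute[of "x n" "x m"])
  qed
  have proj: "filterlim fst sequentially (sequentially \<times>\<^sub>F sequentially)"
    "filterlim snd sequentially (sequentially \<times>\<^sub>F sequentially)"
    unfolding filterlim_def by (fact filtermap_fst_prod_filter filtermap_snd_prod_filter)+
  have "((\<lambda>p. B * (h ^ fst p + h ^ snd p)) \<longlongrightarrow> B * (0 + 0)) (sequentially \<times>\<^sub>F sequentially)"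
    by (intro tendsto_mult tendsto_add tendsto_const filterlim_compose[OF pow] proj)
  then have lim: "((\<lambda>p. B * (h ^ fst p + h ^ snd p)) \<longlongrightarrow> 0) (sequentially \<times>\<^sub>F sequentially)"
    by simp
  have small: "q (x n) (x m) \<le> B * (h ^ n + h ^ m)" "q (x m) (x n) \<le> B * (h ^ n + h ^ m)" for n m
    using bound[of n m] le_sym_dist[OF x_in x_in, of n m] le_sym_dist[OF x_in x_in, of m n]
    by (simp_all add: sym_dist_commute[of "x m" "x n"])
  have "((\<lambda>(n, m). q (x n) (x m)) \<longlongrightarrow> 0) (sequentially \<times>\<^sub>F sequentially)"
    by (rule tendsto_sandwich[OF _ _ tendsto_const lim]; rule always_eventually)
      (auto simp: small nonneg x_in)
  moreover have "((\<lambda>(n, m). q (x m) (x n)) \<longlongrightarrow> 0) (sequentially \<times>\<^sub>F sequentially)"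
    by (rule tendsto_sandwich[OF _ _ tendsto_const lim]; rule always_eventually)
      (auto simp: small nonneg x_in)
  ultimately show ?thesis
    using x by (simp add: zero_Cauchy_def)
qed

end

theorem theorem4p13:
  fixes X :: "'a set" and q :: "'a \<Rightarrow> 'a \<Rightarrow> real" and s :: real
    and T :: "'a \<Rightarrow> 'a" and a\<^sub>1 a\<^sub>2 a\<^sub>3 a\<^sub>4 :: real
  assumes "quasi_partial_b_metric_like_space X q s"
    and "zero_complete X q"
    and "T ` X = X"
    and "\<And>x y. \<lbrakk>x \<in> X; y \<in> X\<rbrakk> \<Longrightarrow>
           q (T x) (T y) \<ge> a\<^sub>1 * (q x y + q y x) + a\<^sub>2 * (q x (T x) + q (T x) x)
                         + a\<^sub>3 * (q y (T y) + q (T y) y) + a\<^sub>4 * (q x (T y) + q (T y) x)"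
    and "a\<^sub>1 > 0" and "a\<^sub>2 > 0" and "a\<^sub>3 > 0" and "a\<^sub>4 > 0"
    and "1 + a\<^sub>4 - a\<^sub>3 > 0"
    and "s * (a\<^sub>1 + a\<^sub>2) + 2 * s^2 * (a\<^sub>3 - a\<^sub>4) + a\<^sub>4 > 2 * s^2"
    and "a\<^sub>1 + a\<^sub>4 \<ge> 1"
  shows "\<exists>!x. x \<in> X \<and> T x = x"
proof -
  interpret quasi_partial_b_metric_like_space X q s
    by (fact assms(1))
  note a_pos = assms(5-8)
  have T_in: "T x \<in> X" if "x \<in> X" for x
    using assms(3) that by blast
  have expand: "a\<^sub>1 * sym_dist x y + a\<^sub>2 * sym_dist x (T x) + a\<^sub>3 * sym_dist y (T y)
      + a\<^sub>4 * sym_dist x (T y) \<le> q (T x) (T y)" if "x \<in> X" "y \<in> X" for x y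
    using assms(4)[OF that] by (simp add: sym_dist_def)
  have s_pos: "0 < s"
    using coefficient by simp

  define K where "K = a\<^sub>1 + a\<^sub>2 + a\<^sub>4 / s"
  define h where "h = (1 + a\<^sub>4 - a\<^sub>3) / K"
  have K: "0 < K"
    using a_pos s_pos by (simp add: K_def add_pos_pos)
  have h: "0 \<le> h" "s * h < 1"
  proof -
    show "0 \<le> h"
      using K assms(9) by (simp add: h_def)
    have "s * K = s * (a\<^sub>1 + a\<^sub>2) + a\<^sub>4"
      using s_pos by (simp add: K_def algebra_simps)
    then have "s * (2 * s * (1 + a\<^sub>4 - a\<^sub>3)) < s * K"
      using assms(10) by (simp add: power2_eq_square algebra_simps)
    then have "2 * (s * (1 + a\<^sub>4 - a\<^sub>3)) < K"
      using s_pos by simp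
    moreover have "0 < s * (1 + a\<^sub>4 - a\<^sub>3)"
      using s_pos assms(9) by simp
    ultimately have "s * (1 + a\<^sub>4 - a\<^sub>3) < K"
      by linarith
    then show "s * h < 1"
      using K by (simp add: h_def)
  qed

  have contract: "sym_dist v w \<le> h * sym_dist (T v) v"
    if v: "v \<in> X" and w: "w \<in> X" "T w = v" for v w
  proof -
    \<comment> \<open>The new step \<open>d v w\<close>, not the old step \<open>d v (T v)\<close>, is the side to estimate: this is what
      puts \<open>a\<^sub>4 / s\<close> into the denominator and \<open>a\<^sub>4\<close> into the numerator of \<open>h\<close>.\<close>
    have "sym_dist v w \<le> s * (sym_dist v (T v) + sym_dist (T v) w)"
      using v w T_in by (intro sym_dist_triangle) auto
    then have "sym_dist v w / s - sym_dist v (T v) \<le> sym_dist w (T v)"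
      using s_pos by (simp add: field_simps sym_dist_commute[of w "T v"])
    then have "a\<^sub>4 * (sym_dist v w / s - sym_dist v (T v)) \<le> a\<^sub>4 * sym_dist w (T v)"
      using a_pos(4) by (intro mult_left_mono) simp_all
    then have "K * sym_dist v w \<le> (1 + a\<^sub>4 - a\<^sub>3) * sym_dist v (T v)"
      using expand[OF w(1) v] le_sym_dist[OF v T_in[OF v]] w(2)
      by (simp add: K_def algebra_simps sym_dist_commute[of w v])
    then show ?thesis
      using K by (simp add: h_def field_simps sym_dist_commute[of "T v" v])
  qed

  define g where "g = inv_into X T"
  have g: "g y \<in> X" "T (g y) = y" if "y \<in> X" for y
    using assms(3) that by (simp_all add: g_def inv_into_into f_inv_into_f)
  obtain x0 where x0: "x0 \<in> X"
    using nonempty by blast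
  define x where "x n = (g ^^ n) x0" for n
  have x_in: "x n \<in> X" for n
    by (induction n) (auto simp: x_def x0 g)
  have T_x: "T (x (Suc n)) = x n" for n
    using g(2)[OF x_in[of n]] by (simp add: x_def)
  have "zero_Cauchy X q x"
  proof (rule geometric_steps_imp_zero_Cauchy[OF _ h])
    show "range x \<subseteq> X"
      using x_in by auto
    show "sym_dist (x (Suc n)) (x (Suc (Suc n))) \<le> h * sym_dist (x n) (x (Suc n))" for n
      using contract[OF x_in x_in T_x, of "Suc n"] by (simp add: T_x)
  qed
  then obtain l where l: "l \<in> X" "(\<lambda>n. q (x n) l) \<longlonglongrightarrow> 0"
    using assms(2) unfolding zero_complete_def by metis

  obtain u where u: "u \<in> X" "T u = l"
    using g l(1) by blast
  have "a\<^sub>3 * sym_dist u l \<le> q (x n) l" for n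
  proof -
    have "0 \<le> a\<^sub>1 * sym_dist (x (Suc n)) u" "0 \<le> a\<^sub>2 * sym_dist (x (Suc n)) (x n)"
      "0 \<le> a\<^sub>4 * sym_dist (x (Suc n)) l"
      using a_pos x_in u(1) l(1) by (simp_all add: sym_dist_nonneg)
    then show ?thesis
      using expand[OF x_in[of "Suc n"] u(1)] by (simp add: T_x u(2))
  qed
  then have "a\<^sub>3 * sym_dist u l \<le> 0"
    using l(2) by (intro LIMSEQ_le_const) auto
  then have "sym_dist u l \<le> 0"
    using a_pos(3) by (simp add: mult_le_0_iff)
  then have "q u l = 0"
    using le_sym_dist[OF u(1) l(1)] nonneg[OF u(1) l(1)] by linarith
  then have "u = l"
    by (rule zero_imp_eq[OF u(1) l(1)])
  then have fixed: "T l = l"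
    using u(2) by simp

  have unique: "y = l" if y: "y \<in> X" "T y = y" for y
  proof -
    have "0 \<le> a\<^sub>2 * sym_dist l l" "0 \<le> a\<^sub>3 * sym_dist y y"
      using a_pos l(1) y(1) by (simp_all add: sym_dist_nonneg)
    then have "(a\<^sub>1 + a\<^sub>4) * sym_dist l y \<le> q l y"
      using expand[OF l(1) y(1)] by (simp add: fixed y(2) distrib_right)
    moreover have "1 * sym_dist l y \<le> (a\<^sub>1 + a\<^sub>4) * sym_dist l y"
      using assms(11) sym_dist_nonneg[OF l(1) y(1)] by (intro mult_right_mono)
    ultimately have "q y l \<le> 0"
      by (simp add: sym_dist_def)
    then show "y = l"
      using nonneg[OF y(1) l(1)] by (intro zero_imp_eq y l) simp
  qed
  show ?thesis
    using l(1) fixed unique by blast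
qed

end
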